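(* Let $\nu_1$ be a class measure on $S_n$ supported on the set of permutations with exactly one fixed point (that is, $\nu_1(\sigma)=0$ for every $\sigma\in S_n$ that does not have exactly one fixed point), and for each $k\ge 2$ let $\nu_k$ be any class measure on $S_n$ (the $\nu_k$ may be different for different $k$). Let $\tau_1,\tau_2,\ldots$ be independent random elements of $S_n$ with $\tau_k$ distributed according to $\nu_k$ for each $k\ge1$. Form the Markov chain $\{X_k\}_{k\ge 0}$ on $S_n$ by letting $X_0$ be the identity and $X_k=\tau_kX_{k-1}$ for all $k\ge 1$. Then for every $k\ge 1$ the expected number of fixed points of $X_k$ is exactly $1$.
   Context: $S_n$ is the symmetric group on $\{1,\ldots,n\}$. A class measure on $S_n$ is a probability measure $\nu$ on $S_n$ that is constant on conjugacy classes: $\nu(\pi\sigma\pi^{-1})=\nu(\sigma)$ for all $\pi,\sigma\in S_n$. A fixed point of $\sigma\in S_n$ is an element $j\in\{1,\ldots,n\}$ with $\sigma(j)=j$. *)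

theory Defs
  imports "HOL-Probability.Probability" "HOL-Combinatorics.Permutations"
begin

abbreviation sym_set :: "nat \<Rightarrow> (nat \<Rightarrow> nat) set" where
  "sym_set n \<equiv> {\<sigma>. \<sigma> permutes {1..n}}"

(* Needed because a permutation of {1..n} is a function on all of nat, which fixes
   every point outside {1..n}. *)
definition fixed_points :: "nat \<Rightarrow> (nat \<Rightarrow> nat) \<Rightarrow> nat set" where
  "fixed_points n \<sigma> = {j \<in> {1..n}. \<sigma> j = j}"

definition class_measure :: "nat \<Rightarrow> (nat \<Rightarrow> nat) measure \<Rightarrow> bool" where
  "class_measure n \<nu> \<longleftrightarrow>
     prob_space \<nu> \<and> space \<nu> = sym_set n \<and> sets \<nu> = Pow (sym_set n) \<and>
     (\<forall>\<pi> \<in> sym_set n. \<forall>\<sigma> \<in> sym_set n. measure \<nu> {\<pi> \<circ> \<sigma> \<circ> inv \<pi>} = measure \<nu> {\<sigma>})"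

(* The steps are indexed from 1; the value of tau at 0 is never used. *)
primrec walk :: "(nat \<Rightarrow> 'a \<Rightarrow> nat \<Rightarrow> nat) \<Rightarrow> nat \<Rightarrow> 'a \<Rightarrow> nat \<Rightarrow> nat" where
  "walk \<tau> 0 \<omega> = id"
| "walk \<tau> (Suc k) \<omega> = \<tau> (Suc k) \<omega> \<circ> walk \<tau> k \<omega>"

end

theory Submission imports Defs begin

text \<open>
  Follow single points. For a class measure \<open>\<nu>\<close>, the probability of carrying the point \<open>i\<close>
  to the point \<open>j\<close> depends only on whether \<open>i = j\<close>, because conjugation moves the pair
  \<open>(i, j)\<close> to any other pair of the same kind. The \<open>n\<close> diagonal probabilities add up to the expected
  number of fixed points. When that is \<open>1\<close>, each of them is \<open>1/n\<close>, and since each row sums to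
  \<open>1\<close>, the others are \<open>1/n\<close> as well: the image of every point is uniformly distributed
  (\<open>uniform_transition_if_one_fixed_point\<close>).

  Uniformity of the images then persists. The point-to-point probabilities of an arbitrary
  random permutation form a doubly stochastic matrix, so an independent step carries a uniformly
  distributed point to a uniformly distributed point (\<open>uniform_image_compose\<close>). Hence
  \<open>X\<^sub>k(j) = j\<close> has probability \<open>1/n\<close> for each of the \<open>n\<close> points \<open>j\<close> and each
  \<open>k \<ge> 1\<close>, and the expected number of fixed points is \<open>n \<cdot> 1/n = 1\<close>.
\<close>

text \<open>
  Linearity of expectation for counting variables. It yields the row and column sums and the trace
  of the point-to-point probabilities, and the final count of fixed points.
\<close>

lemma (in prob_space) sum_prob_eq_expectation_card:
  assumes "finite J" and "\<And>j. j \<in> J \<Longrightarrow> {\<omega> \<in> space M. P j \<omega>} \<in> events"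
  shows "(\<Sum>j\<in>J. prob {\<omega> \<in> space M. P j \<omega>}) = expectation (\<lambda>\<omega>. real (card {j \<in> J. P j \<omega>}))"
proof -
  have "(\<Sum>j\<in>J. prob {\<omega> \<in> space M. P j \<omega>})
      = (\<Sum>j\<in>J. expectation (indicator {\<omega> \<in> space M. P j \<omega>}))"
    using assms(2) by (intro sum.cong) (auto simp: Int_absorb1)
  also have "\<dots> = expectation (\<lambda>\<omega>. \<Sum>j\<in>J. indicator {\<omega> \<in> space M. P j \<omega>} \<omega>)"
    using assms(2) by (intro Bochner_Integration.integral_sum[symmetric]) (auto simp: emeasure_eq_measure)
  also have "\<dots> = expectation (\<lambda>\<omega>. real (card {j \<in> J. P j \<omega>}))"
  proof (rule Bochner_Integration.integral_cong[OF refl])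
    fix \<omega> assume "\<omega> \<in> space M"
    then have "(\<Sum>j\<in>J. indicator {\<omega> \<in> space M. P j \<omega>} \<omega>) = (\<Sum>j\<in>J. if P j \<omega> then 1 else 0 :: real)"
      by (intro sum.cong) (auto simp: indicator_def)
    also have "\<dots> = real (card {j \<in> J. P j \<omega>})"
      using assms(1) by (simp add: sum.If_cases Int_def)
    finally show "(\<Sum>j\<in>J. indicator {\<omega> \<in> space M. P j \<omega>} \<omega>) = real (card {j \<in> J. P j \<omega>})" .
  qed
  finally show ?thesis .
qed

section \<open>Point-to-point probabilities of a random permutation\<close>

abbreviation transition :: "nat \<Rightarrow> (nat \<Rightarrow> nat) measure \<Rightarrow> nat \<Rightarrow> nat \<Rightarrow> real" where
  "transition n \<nu> i j \<equiv> measure \<nu> {\<sigma> \<in> sym_set n. \<sigma> i = j}"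

lemma transition_row_sum:
  assumes "prob_space \<nu>" "space \<nu> = sym_set n" "sets \<nu> = Pow (sym_set n)" "i \<in> {1..n}"
  shows "(\<Sum>j\<in>{1..n}. transition n \<nu> i j) = 1"
proof -
  interpret prob_space \<nu> by fact
  have "(\<Sum>j\<in>{1..n}. transition n \<nu> i j)
      = expectation (\<lambda>\<sigma>. real (card {j \<in> {1..n}. \<sigma> i = j}))"
    using assms by (subst sum_prob_eq_expectation_card[symmetric]) auto
  also have "\<dots> = expectation (\<lambda>\<sigma>. 1)"
  proof (rule Bochner_Integration.integral_cong[OF refl])
    fix \<sigma> assume "\<sigma> \<in> space \<nu>"
    then have "{j \<in> {1..n}. \<sigma> i = j} = {\<sigma> i}"
      using assms permutes_in_image[of \<sigma> "{1..n}" i] by auto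
    then show "real (card {j \<in> {1..n}. \<sigma> i = j}) = 1" by simp
  qed
  finally show ?thesis by (simp add: prob_space)
qed

lemma transition_column_sum:
  assumes "prob_space \<nu>" "space \<nu> = sym_set n" "sets \<nu> = Pow (sym_set n)" "j \<in> {1..n}"
  shows "(\<Sum>i\<in>{1..n}. transition n \<nu> i j) = 1"
proof -
  interpret prob_space \<nu> by fact
  have "(\<Sum>i\<in>{1..n}. transition n \<nu> i j)
      = expectation (\<lambda>\<sigma>. real (card {i \<in> {1..n}. \<sigma> i = j}))"
    using assms by (subst sum_prob_eq_expectation_card[symmetric]) auto
  also have "\<dots> = expectation (\<lambda>\<sigma>. 1)"
  proof (rule Bochner_Integration.integral_cong[OF refl])
    fix \<sigma> assume "\<sigma> \<in> space \<nu>"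
    then have \<sigma>: "\<sigma> permutes {1..n}" using assms by simp
    then have "{i \<in> {1..n}. \<sigma> i = j} = {inv \<sigma> j}"
      using assms(4) permutes_in_image[OF permutes_inv[OF \<sigma>], of j] permutes_inverses[OF \<sigma>] by auto
    then show "real (card {i \<in> {1..n}. \<sigma> i = j}) = 1" by simp
  qed
  finally show ?thesis by (simp add: prob_space)
qed

text \<open>
  Conjugation by \<open>\<pi>\<close> is a bijection from the permutations carrying \<open>i\<close> to \<open>j\<close> onto those carrying
  \<open>\<pi> i\<close> to \<open>\<pi> j\<close>, and a class measure gives corresponding permutations the same mass.
\<close>

lemma transition_conjugation:
  assumes "class_measure n \<nu>" and \<pi>: "\<pi> permutes {1..n}"
  shows "transition n \<nu> (\<pi> i) (\<pi> j) = transition n \<nu> i j"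
proof -
  interpret prob_space \<nu> using assms by (simp add: class_measure_def)
  have sets: "sets \<nu> = Pow (sym_set n)" using assms by (simp add: class_measure_def)
  have fin: "finite {\<sigma> \<in> sym_set n. \<sigma> k = l}" for k l
    by (rule finite_subset[OF _ finite_permutations[of "{1..n}"]]) auto
  have cancel: "\<pi> \<circ> (inv \<pi> \<circ> \<sigma> \<circ> \<pi>) \<circ> inv \<pi> = \<sigma>" for \<sigma> :: "nat \<Rightarrow> nat"
    by (simp add: fun_eq_iff permutes_inverses[OF \<pi>])
  have "transition n \<nu> (\<pi> i) (\<pi> j) = (\<Sum>\<sigma>\<in>{\<sigma> \<in> sym_set n. \<sigma> (\<pi> i) = \<pi> j}. measure \<nu> {\<sigma>})"
    using fin sets by (intro finite_measure_eq_sum_singleton) auto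
  also have "\<dots> = (\<Sum>\<sigma>\<in>{\<sigma> \<in> sym_set n. \<sigma> i = j}. measure \<nu> {\<pi> \<circ> \<sigma> \<circ> inv \<pi>})"
  proof (rule sum.reindex_bij_witness[where i = "\<lambda>\<sigma>. \<pi> \<circ> \<sigma> \<circ> inv \<pi>" and j = "\<lambda>\<sigma>. inv \<pi> \<circ> \<sigma> \<circ> \<pi>"])
  qed (use \<pi> in \<open>auto simp: cancel fun_eq_iff permutes_inverses[OF \<pi>] intro!: permutes_compose permutes_inv\<close>)
  also have "\<dots> = (\<Sum>\<sigma>\<in>{\<sigma> \<in> sym_set n. \<sigma> i = j}. measure \<nu> {\<sigma>})"
    using assms by (intro sum.cong) (auto simp: class_measure_def)
  also have "\<dots> = transition n \<nu> i j"
    using fin sets by (intro finite_measure_eq_sum_singleton[symmetric]) auto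
  finally show ?thesis .
qed

lemma transition_trace:
  assumes "prob_space \<nu>" "space \<nu> = sym_set n" "sets \<nu> = Pow (sym_set n)"
    and one: "\<And>\<sigma>. \<sigma> \<in> sym_set n \<Longrightarrow> card (fixed_points n \<sigma>) \<noteq> 1 \<Longrightarrow> measure \<nu> {\<sigma>} = 0"
  shows "(\<Sum>i\<in>{1..n}. transition n \<nu> i i) = 1"
proof -
  interpret prob_space \<nu> by fact
  have "finite (sym_set n)" by (simp add: finite_permutations)
  then have "measure \<nu> {\<sigma> \<in> sym_set n. card (fixed_points n \<sigma>) \<noteq> 1} = 0"
    using assms by (subst finite_measure_eq_sum_singleton) auto
  then have "AE \<sigma> in \<nu>. card (fixed_points n \<sigma>) = 1"
    using assms by (subst AE_iff_measurable[OF _ refl]) (auto simp: emeasure_eq_measure)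
  then have "expectation (\<lambda>\<sigma>. real (card (fixed_points n \<sigma>))) = expectation (\<lambda>\<sigma>. 1)"
    using assms by (intro integral_cong_AE) (auto simp: measurable_def elim: AE_mp)
  moreover have "(\<Sum>i\<in>{1..n}. transition n \<nu> i i) = expectation (\<lambda>\<sigma>. real (card (fixed_points n \<sigma>)))"
    using assms unfolding fixed_points_def
    by (subst sum_prob_eq_expectation_card[symmetric]) auto
  ultimately show ?thesis by (simp add: prob_space)
qed

text \<open>
  Transpositions already show that all diagonal entries agree and that, within one row, all
  off-diagonal entries agree; trace and row sums then determine both values.
\<close>

lemma uniform_transition_if_one_fixed_point:
  assumes cm: "class_measure n \<nu>"
    and one: "\<And>\<sigma>. \<sigma> \<in> sym_set n \<Longrightarrow> card (fixed_points n \<sigma>) \<noteq> 1 \<Longrightarrow> measure \<nu> {\<sigma>} = 0"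
    and i: "i \<in> {1..n}" and j: "j \<in> {1..n}"
  shows "transition n \<nu> i j = 1 / n"
proof -
  have \<nu>: "prob_space \<nu>" "space \<nu> = sym_set n" "sets \<nu> = Pow (sym_set n)"
    using cm by (auto simp: class_measure_def)
  have diag: "transition n \<nu> k k = transition n \<nu> i i" if "k \<in> {1..n}" for k
    using transition_conjugation[OF cm permutes_swap_id[OF i that], of i i] by simp
  have "(\<Sum>k\<in>{1..n}. transition n \<nu> k k) = (\<Sum>k\<in>{1..n}. transition n \<nu> i i)"
    by (intro sum.cong refl diag)
  then have "real n * transition n \<nu> i i = 1"
    using transition_trace[OF \<nu> one] by simp
  then have ii: "transition n \<nu> i i = 1 / n"
    using i by (simp add: field_simps)
  show ?thesis
  proof (cases "i = j")
    case False
    have off: "transition n \<nu> i k = transition n \<nu> i j" if "k \<in> {1..n} - {i}" for k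
      using transition_conjugation[OF cm permutes_swap_id[OF j], of k i j] that False
      by (simp add: transpose_apply_other)
    have "1 = transition n \<nu> i i + (\<Sum>k\<in>{1..n} - {i}. transition n \<nu> i k)"
      using transition_row_sum[OF \<nu> i] i by (simp add: sum.remove[of _ i])
    also have "(\<Sum>k\<in>{1..n} - {i}. transition n \<nu> i k) = (\<Sum>k\<in>{1..n} - {i}. transition n \<nu> i j)"
      by (intro sum.cong refl off)
    also have "\<dots> = (real n - 1) * transition n \<nu> i j"
      using i by (simp add: of_nat_diff)
    finally have *: "1 = 1 / n + (real n - 1) * transition n \<nu> i j" by (simp only: ii)
    have "n > 1" using i j False by auto
    with * have eq: "(real n - 1) * transition n \<nu> i j = (real n - 1) * (1 / n)"
      by (simp add: field_simps)
    have "real n - 1 \<noteq> 0" using \<open>n > 1\<close> by simp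
    from mult_left_cancel[OF this] eq show ?thesis by (rule iffD1)
  qed (use ii in simp)
qed

section \<open>Independent steps\<close>

lemma preimage_point_event:
  assumes "X \<in> M \<rightarrow>\<^sub>M count_space (sym_set n)"
  shows "X -` {\<sigma> \<in> sym_set n. \<sigma> a = b} \<inter> space M = {\<omega> \<in> space M. X \<omega> a = b}"
  using measurable_space[OF assms] by auto

lemma sets_point_event:
  assumes "X \<in> M \<rightarrow>\<^sub>M count_space (sym_set n)"
  shows "{\<omega> \<in> space M. X \<omega> a = b} \<in> sets M"
  by (subst preimage_point_event[OF assms, symmetric], rule measurable_sets[OF assms]) auto

lemma transition_distr:
  assumes "X \<in> M \<rightarrow>\<^sub>M count_space (sym_set n)"
  shows "transition n (distr M (count_space (sym_set n)) X) a b
      = measure M {\<omega> \<in> space M. X \<omega> a = b}"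
proof -
  have "{\<sigma> \<in> sym_set n. \<sigma> a = b} \<in> sets (count_space (sym_set n))" by auto
  from measure_distr[OF assms this] show ?thesis
    by (simp only: preimage_point_event[OF assms])
qed

lemma walk_permutes:
  assumes "\<And>i. i \<in> {1..k} \<Longrightarrow> \<tau> i \<omega> permutes S"
  shows "walk \<tau> k \<omega> permutes S"
  using assms by (induction k) (auto intro!: permutes_compose permutes_id)

lemma walk_cong:
  assumes "\<And>i. i \<in> {1..k} \<Longrightarrow> \<tau> i \<omega> = \<tau>' i \<omega>'"
  shows "walk \<tau> k \<omega> = walk \<tau>' k \<omega>'"
  using assms by (induction k) auto

text \<open>
  The walk up to time \<open>k\<close> is a function of the first \<open>k\<close> steps, and on the finite, discrete space of
  \<open>k\<close>-tuples of permutations every function is measurable.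
\<close>

lemma (in prob_space) indep_walk_next_step:
  assumes "indep_vars (\<lambda>_. count_space (sym_set n)) \<tau> {1..}"
  shows "indep_var (count_space (sym_set n)) (walk \<tau> k) (count_space (sym_set n)) (\<tau> (Suc k))"
proof -
  \<comment> \<open>The walk on the canonical sample space, whose points are the sequences of steps themselves.\<close>
  define W where "W = (\<lambda>f :: nat \<Rightarrow> nat \<Rightarrow> nat. walk (\<lambda>i f. f i) k f)"
  let ?S = "count_space (sym_set n)"
  have cnt: "countable (sym_set n)"
    by (intro countable_finite finite_permutations) simp
  have "indep_var (PiM {1..k} (\<lambda>_. ?S)) (\<lambda>\<omega>. restrict (\<lambda>i. \<tau> i \<omega>) {1..k})
      (PiM {Suc k} (\<lambda>_. ?S)) (\<lambda>\<omega>. restrict (\<lambda>i. \<tau> i \<omega>) {Suc k})"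
    by (rule indep_var_restrict[OF assms]) auto
  moreover have "W \<in> PiM {1..k} (\<lambda>_. ?S) \<rightarrow>\<^sub>M ?S"
    unfolding count_space_PiM_finite[OF finite_atLeastAtMost cnt]
    by (auto simp: W_def PiE_iff intro!: walk_permutes)
  moreover have "(\<lambda>f. f (Suc k)) \<in> PiM {Suc k} (\<lambda>_. ?S) \<rightarrow>\<^sub>M ?S"
    by (rule measurable_component_singleton) simp
  ultimately have "indep_var ?S (W \<circ> (\<lambda>\<omega>. restrict (\<lambda>i. \<tau> i \<omega>) {1..k}))
      ?S ((\<lambda>f. f (Suc k)) \<circ> (\<lambda>\<omega>. restrict (\<lambda>i. \<tau> i \<omega>) {Suc k}))"
    by (rule indep_var_compose)
  moreover have "W \<circ> (\<lambda>\<omega>. restrict (\<lambda>i. \<tau> i \<omega>) {1..k}) = walk \<tau> k"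
    by (auto simp: W_def fun_eq_iff intro!: walk_cong fun_cong[of "walk _ _ _"])
  moreover have "(\<lambda>f. f (Suc k)) \<circ> (\<lambda>\<omega>. restrict (\<lambda>i. \<tau> i \<omega>) {Suc k}) = \<tau> (Suc k)"
    by (auto simp: fun_eq_iff)
  ultimately show ?thesis by simp
qed

text \<open>
  Split according to the intermediate point \<open>X i\<close>. Its uniform weight \<open>1/n\<close> factors out and leaves a
  column sum of the transition matrix of the second step.
\<close>

lemma (in prob_space) uniform_image_compose:
  assumes ind: "indep_var (count_space (sym_set n)) X (count_space (sym_set n)) T"
    and unif: "\<And>m. m \<in> {1..n} \<Longrightarrow> prob {\<omega> \<in> space M. X \<omega> i = m} = 1 / n"
    and i: "i \<in> {1..n}" and j: "j \<in> {1..n}"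
  shows "prob {\<omega> \<in> space M. (T \<omega> \<circ> X \<omega>) i = j} = 1 / n"
proof -
  let ?S = "count_space (sym_set n)"
  have X: "X \<in> M \<rightarrow>\<^sub>M ?S" and T: "T \<in> M \<rightarrow>\<^sub>M ?S"
    using indep_var_rv1[OF ind] indep_var_rv2[OF ind] by auto
  let ?\<nu> = "distr M ?S T"
  have \<nu>: "prob_space ?\<nu>" by (rule prob_space_distr) fact
  have prod: "prob {\<omega> \<in> space M. X \<omega> i = m \<and> T \<omega> m = j} = 1 / n * transition n ?\<nu> m j"
    if "m \<in> {1..n}" for m
  proof -
    have "prob {\<omega> \<in> space M. X \<omega> i = m \<and> T \<omega> m = j}
        = prob ((\<lambda>\<omega>. (X \<omega>, T \<omega>)) -` ({\<sigma> \<in> sym_set n. \<sigma> i = m} \<times> {\<sigma> \<in> sym_set n. \<sigma> m = j}) \<inter> space M)"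
      using measurable_space[OF X] measurable_space[OF T] by (intro arg_cong[where f = prob]) auto
    also have "\<dots> = prob (X -` {\<sigma> \<in> sym_set n. \<sigma> i = m} \<inter> space M)
        * prob (T -` {\<sigma> \<in> sym_set n. \<sigma> m = j} \<inter> space M)"
      by (rule indep_varD[OF ind]) auto
    also have "\<dots> = 1 / n * transition n ?\<nu> m j"
      by (simp only: preimage_point_event[OF X] preimage_point_event[OF T] transition_distr[OF T] unif[OF that])
    finally show ?thesis .
  qed
  have "{\<omega> \<in> space M. (T \<omega> \<circ> X \<omega>) i = j} = (\<Union>m\<in>{1..n}. {\<omega> \<in> space M. X \<omega> i = m \<and> T \<omega> m = j})"
    using measurable_space[OF X] permutes_in_image[of _ "{1..n}" i] i by auto
  then have "prob {\<omega> \<in> space M. (T \<omega> \<circ> X \<omega>) i = j}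
      = (\<Sum>m\<in>{1..n}. prob {\<omega> \<in> space M. X \<omega> i = m \<and> T \<omega> m = j})"
    using sets.Int[OF sets_point_event[OF X] sets_point_event[OF T]]
    by (subst finite_measure_finite_Union[symmetric])
       (auto simp: disjoint_family_on_def Int_def conj_ac cong: conj_cong)
  also have "\<dots> = 1 / n * (\<Sum>m\<in>{1..n}. transition n ?\<nu> m j)"
    by (simp add: prod sum_distrib_left)
  also have "(\<Sum>m\<in>{1..n}. transition n ?\<nu> m j) = 1"
    using \<nu> j by (intro transition_column_sum) auto
  finally show ?thesis by simp
qed

section \<open>The expected number of fixed points\<close>

theorem proposition2:
  fixes n :: nat
    and \<nu> :: "nat \<Rightarrow> (nat \<Rightarrow> nat) measure"
    and M :: "'a measure"
    and \<tau> :: "nat \<Rightarrow> 'a \<Rightarrow> nat \<Rightarrow> nat"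
  assumes "class_measure n (\<nu> 1)"
    and "\<forall>\<sigma> \<in> sym_set n. card (fixed_points n \<sigma>) \<noteq> 1 \<longrightarrow> measure (\<nu> 1) {\<sigma>} = 0"
    and "\<forall>k\<ge>2. class_measure n (\<nu> k)"
    and "prob_space M"
    and "prob_space.indep_vars M (\<lambda>_. count_space (sym_set n)) \<tau> {1..}"
    and "\<forall>k\<ge>1. distr M (count_space (sym_set n)) (\<tau> k) = \<nu> k"
  shows "\<forall>k\<ge>1. (\<integral>\<omega>. real (card (fixed_points n (walk \<tau> k \<omega>))) \<partial>M) = 1"
proof (intro allI impI)
  interpret prob_space M by fact
  let ?S = "count_space (sym_set n)"
  note ind = indep_walk_next_step[OF assms(5)]
  have walk_uniform: "prob {\<omega> \<in> space M. walk \<tau> (Suc k) \<omega> i = j} = 1 / n"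
    if "i \<in> {1..n}" "j \<in> {1..n}" for k i j
    using that
  proof (induction k arbitrary: j)
    case 0
    have \<tau>1: "\<tau> 1 \<in> M \<rightarrow>\<^sub>M ?S" using indep_var_rv2[OF ind[of 0]] by simp
    have "prob {\<omega> \<in> space M. \<tau> 1 \<omega> i = j} = transition n (distr M ?S (\<tau> 1)) i j"
      by (rule transition_distr[OF \<tau>1, symmetric])
    also have "distr M ?S (\<tau> 1) = \<nu> 1" using assms(6) by simp
    also have "transition n (\<nu> 1) i j = 1 / n"
      using assms(1,2) 0 by (intro uniform_transition_if_one_fixed_point) auto
    finally show ?case by simp
  next
    case (Suc k)
    show ?case
      using uniform_image_compose[OF ind[of "Suc k"] Suc.IH, OF Suc.prems(1) _ Suc.prems]
      by simp
  qed
  have n_pos: "n > 0"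
  proof (rule ccontr)
    \<comment> \<open>For \<open>n = 0\<close> no permutation has a fixed point, so the support hypothesis would kill all the mass.\<close>
    assume "\<not> n > 0"
    then have "(\<Sum>i\<in>{1..n}. transition n (\<nu> 1) i i) = 0" by simp
    then show False
      using transition_trace[of "\<nu> 1" n] assms(1,2) by (auto simp: class_measure_def)
  qed
  fix k :: nat
  assume "k \<ge> 1"
  then obtain l where k: "k = Suc l" by (cases k) auto
  have X: "walk \<tau> k \<in> M \<rightarrow>\<^sub>M ?S" by (rule indep_var_rv1[OF ind])
  have "(\<integral>\<omega>. real (card (fixed_points n (walk \<tau> k \<omega>))) \<partial>M)
      = (\<Sum>j\<in>{1..n}. prob {\<omega> \<in> space M. walk \<tau> k \<omega> j = j})"
    unfolding fixed_points_def
    by (intro sum_prob_eq_expectation_card[symmetric] sets_point_event[OF X]) simp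
  also have "\<dots> = (\<Sum>j\<in>{1..n}. 1 / n)"
    unfolding k by (intro sum.cong refl walk_uniform)
  also have "\<dots> = 1" using n_pos by simp
  finally show "(\<integral>\<omega>. real (card (fixed_points n (walk \<tau> k \<omega>))) \<partial>M) = 1" .
qed

end
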